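(* Let $E$ be a Banach lattice. If $T:E\to E$ is a $\sigma$-weak-uo continuous power uo-demi Dunford–Pettis operator, then $T$ is uo-demi Dunford–Pettis.
   Context: All Banach lattices are real; "operator" means bounded linear map. A net $(x_\alpha)$ in a Banach lattice $E$ is uo-convergent (unbounded order convergent) to $x$, written $x_\alpha\xrightarrow{uo}x$, if $|x_\alpha-x|\wedge y$ converges in order to $0$ for every $y\in E^+$. An operator $T:E\to E$ on a Banach lattice $E$ is uo-demi Dunford–Pettis (unbounded order demi Dunford–Pettis) if for every weakly null sequence $(x_n)$ in $E$ such that $(x_n-T(x_n))$ is uo-convergent to $0$, one has $\|x_n\|\to0$. An operator $T:E\to E$ is power uo-demi Dunford–Pettis if $T^m$ is uo-demi Dunford–Pettis for some $m\in\mathbb{N}$. An operator $T:E\to E$ is $\sigma$-weak-uo continuous if $T(x_n)\xrightarrow{uo}0$ in $E$ for every weakly null sequence $(x_n)$ in $E$. *)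

theory Defs
  imports "HOL-Analysis.Analysis" "HOL-Library.Lattice_Algebras" "HOL-Library.Lub_Glb"
begin

class banach_lattice = banach + ordered_real_vector + lattice_ab_group_add_abs +
  assumes norm_mono_abs: "\<bar>x\<bar> \<le> \<bar>y\<bar> \<Longrightarrow> norm x \<le> norm y"

instance real :: banach_lattice
  by standard simp

text \<open>
  A net is represented by a function together with the filter of eventual events of its index
  set; a sequence is the case of the filter \<open>sequentially\<close>. Order convergence to \<open>x\<close> asks for a
  net \<open>y\<^sub>\<beta>\<close> decreasing to \<open>0\<close>, whose index set may differ from that of \<open>f\<close>, such that for every
  \<open>\<beta>\<close> eventually \<open>\<bar>f \<alpha> - x\<bar> \<le> y\<^sub>\<beta>\<close>. Only the range \<open>D\<close> of the net \<open>y\<^sub>\<beta>\<close> matters, and the ranges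
  of such nets are exactly the nonempty downward directed sets with infimum \<open>0\<close> (index \<open>D\<close> by
  itself with the reversed order).
\<close>

definition order_convergent_to ::
    "('i \<Rightarrow> 'a::banach_lattice) \<Rightarrow> 'a \<Rightarrow> 'i filter \<Rightarrow> bool" where
  "order_convergent_to f x F \<longleftrightarrow>
    (\<exists>D. D \<noteq> {} \<and> (\<forall>a\<in>D. \<forall>b\<in>D. \<exists>c\<in>D. c \<le> a \<and> c \<le> b) \<and> isGlb UNIV D 0 \<and>
         (\<forall>d\<in>D. \<forall>\<^sub>F \<alpha> in F. \<bar>f \<alpha> - x\<bar> \<le> d))"

definition uo_convergent_to ::
    "('i \<Rightarrow> 'a::banach_lattice) \<Rightarrow> 'a \<Rightarrow> 'i filter \<Rightarrow> bool" where
  "uo_convergent_to f x F \<longleftrightarrow>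
    (\<forall>y\<ge>0. order_convergent_to (\<lambda>\<alpha>. inf \<bar>f \<alpha> - x\<bar> y) 0 F)"

definition weakly_null :: "(nat \<Rightarrow> 'a::real_normed_vector) \<Rightarrow> bool" where
  "weakly_null x \<longleftrightarrow> (\<forall>\<phi>::'a \<Rightarrow> real. bounded_linear \<phi> \<longrightarrow> (\<lambda>n. \<phi> (x n)) \<longlonglongrightarrow> 0)"

definition uo_demi_dunford_pettis :: "('a::banach_lattice \<Rightarrow> 'a) \<Rightarrow> bool" where
  "uo_demi_dunford_pettis T \<longleftrightarrow> bounded_linear T \<and>
    (\<forall>x. weakly_null x \<and> uo_convergent_to (\<lambda>n. x n - T (x n)) 0 sequentially
       \<longrightarrow> (\<lambda>n. norm (x n)) \<longlonglongrightarrow> 0)"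

definition power_uo_demi_dunford_pettis :: "('a::banach_lattice \<Rightarrow> 'a) \<Rightarrow> bool" where
  "power_uo_demi_dunford_pettis T \<longleftrightarrow> bounded_linear T \<and>
    (\<exists>m\<ge>1. uo_demi_dunford_pettis (T ^^ m))"

definition sigma_weak_uo_continuous :: "('a::banach_lattice \<Rightarrow> 'a) \<Rightarrow> bool" where
  "sigma_weak_uo_continuous T \<longleftrightarrow> bounded_linear T \<and>
    (\<forall>x. weakly_null x \<longrightarrow> uo_convergent_to (\<lambda>n. T (x n)) 0 sequentially)"

end

theory Submission
  imports Defs
begin

text \<open>
  If \<open>x\<^sub>n\<close> is weakly null, then so is \<open>T\<^sup>m\<^sup>-\<^sup>1 x\<^sub>n\<close>, hence both \<open>T x\<^sub>n\<close> and \<open>T\<^sup>m x\<^sub>n\<close> are uo-null by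
  \<open>\<sigma>\<close>-weak-uo continuity. Thus if \<open>x\<^sub>n - T x\<^sub>n\<close> is uo-null, so is
  \<open>x\<^sub>n - T\<^sup>m x\<^sub>n = (x\<^sub>n - T x\<^sub>n) + T x\<^sub>n - T\<^sup>m x\<^sub>n\<close>.
\<close>

text \<open>Distributing \<open>+\<close> over \<open>inf\<close> turns the right-hand side into the
  infimum of \<open>u + v\<close>, \<open>y + v\<close>, \<open>u + y\<close> and
  \<open>y + y\<close>. By positivity the last three lie above \<open>y\<close>.\<close>

lemma inf_add_le_add_inf:
  fixes u v y :: "'a::lattice_ab_group_add"
  assumes "0 \<le> u" "0 \<le> v" "0 \<le> y"
  shows "inf (u + v) y \<le> inf u y + inf v y"
proof -
  have "inf u y + inf v y = inf (inf (u + v) (y + v)) (inf (u + y) (y + y))"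
    by (simp add: add_inf_distrib_left add_inf_distrib_right)
  moreover have "y \<le> y + v" "y \<le> u + y" "y \<le> y + y"
    using assms by simp_all
  ultimately show ?thesis
    by (auto intro: le_infI2)
qed

lemma isGlb_UNIV_iff:
  "isGlb UNIV A x \<longleftrightarrow> (\<forall>a\<in>A. x \<le> a) \<and> (\<forall>l. (\<forall>a\<in>A. l \<le> a) \<longrightarrow> l \<le> x)"
  by (simp add: isGlb_def isLb_def greatestP_def setle_def setge_def)

text \<open>For a lower bound \<open>l\<close> of the sums and a fixed \<open>a\<close> in
  \<open>A\<close>, \<open>l - a\<close> is a lower bound of \<open>B\<close>, hence at most 0. So
  \<open>l\<close> bounds \<open>A\<close> from below, and \<open>l \<le> 0\<close> follows.\<close>

lemma isGlb_sums:
  fixes A B :: "'a::ordered_ab_group_add set"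
  assumes A: "isGlb UNIV A 0" and B: "isGlb UNIV B 0"
  shows "isGlb UNIV {a + b |a b. a \<in> A \<and> b \<in> B} 0"
  unfolding isGlb_UNIV_iff
proof (intro conjI allI impI ballI)
  fix c
  assume "c \<in> {a + b |a b. a \<in> A \<and> b \<in> B}"
  then show "0 \<le> c"
    using A B by (auto simp: isGlb_UNIV_iff)
next
  fix l
  assume l: "\<forall>c\<in>{a + b |a b. a \<in> A \<and> b \<in> B}. l \<le> c"
  have "l \<le> a" if "a \<in> A" for a
  proof -
    have "l - a \<le> b" if "b \<in> B" for b
    proof -
      have "l \<le> a + b"
        using l \<open>a \<in> A\<close> that by blast
      then show ?thesis
        by (simp add: diff_le_eq add.commute)
    qed
    then have "l - a \<le> 0"
      using B unfolding isGlb_UNIV_iff by blast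
    then show ?thesis by simp
  qed
  then show "l \<le> 0"
    using A unfolding isGlb_UNIV_iff by blast
qed

text \<open>Sums of a dominating element for \<open>f\<close> and one for \<open>g\<close>
  eventually dominate \<open>h\<close>. Asking for a bound on \<open>h\<close> rather than
  \<open>h = f + g\<close> lets the lemma apply to truncations \<open>inf \<bar>f i\<bar> y\<close>,
  which are subadditive but not additive.\<close>

lemma order_convergent_to_0_sum_bound:
  fixes f g h :: "'i \<Rightarrow> 'a::banach_lattice"
  assumes f: "order_convergent_to f 0 F" and g: "order_convergent_to g 0 F"
    and le: "\<And>i. \<bar>h i\<bar> \<le> \<bar>f i\<bar> + \<bar>g i\<bar>"
  shows "order_convergent_to h 0 F"
proof -
  obtain A where A: "A \<noteq> {}" "\<And>a b. a \<in> A \<Longrightarrow> b \<in> A \<Longrightarrow> \<exists>c\<in>A. c \<le> a \<and> c \<le> b"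
    "isGlb UNIV A 0" "\<And>d. d \<in> A \<Longrightarrow> \<forall>\<^sub>F i in F. \<bar>f i\<bar> \<le> d"
    using f unfolding order_convergent_to_def by auto
  obtain B where B: "B \<noteq> {}" "\<And>a b. a \<in> B \<Longrightarrow> b \<in> B \<Longrightarrow> \<exists>c\<in>B. c \<le> a \<and> c \<le> b"
    "isGlb UNIV B 0" "\<And>d. d \<in> B \<Longrightarrow> \<forall>\<^sub>F i in F. \<bar>g i\<bar> \<le> d"
    using g unfolding order_convergent_to_def by auto
  define D where "D = {a + b |a b. a \<in> A \<and> b \<in> B}"
  have "D \<noteq> {}"
    using A(1) B(1) by (auto simp: D_def)
  moreover have "\<exists>r\<in>D. r \<le> p \<and> r \<le> q" if pq: "p \<in> D" "q \<in> D" for p q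
  proof -
    obtain a b a' b' where p: "p = a + b" "a \<in> A" "b \<in> B" and q: "q = a' + b'" "a' \<in> A" "b' \<in> B"
      using pq unfolding D_def by blast
    \<comment> \<open>Directedness passes to \<open>D\<close> summand by summand: the common lower
      bounds found in \<open>A\<close> and in \<open>B\<close> are added.\<close>
    obtain c c' where "c \<in> A" "c \<le> a" "c \<le> a'" "c' \<in> B" "c' \<le> b" "c' \<le> b'"
      using A(2)[OF p(2) q(2)] B(2)[OF p(3) q(3)] by blast
    then have "c + c' \<in> D" "c + c' \<le> p" "c + c' \<le> q"
      unfolding D_def p q by (auto intro: add_mono)
    then show ?thesis by blast
  qed
  moreover have "isGlb UNIV D 0"
    unfolding D_def by (rule isGlb_sums[OF A(3) B(3)])
  moreover have "\<forall>\<^sub>F i in F. \<bar>h i - 0\<bar> \<le> d" if D: "d \<in> D" for d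
  proof -
    obtain a b where d: "d = a + b" "a \<in> A" "b \<in> B"
      using D unfolding D_def by blast
    show ?thesis
      using A(4)[OF d(2)] B(4)[OF d(3)]
    proof eventually_elim
      case (elim i)
      have "\<bar>h i\<bar> \<le> \<bar>f i\<bar> + \<bar>g i\<bar>" by (rule le)
      also have "\<dots> \<le> d"
        unfolding d(1) using elim by (rule add_mono)
      finally show ?case by simp
    qed
  qed
  ultimately show ?thesis
    unfolding order_convergent_to_def by blast
qed

lemma uo_convergent_to_0_add:
  fixes f g :: "'i \<Rightarrow> 'a::banach_lattice"
  assumes "uo_convergent_to f 0 F" "uo_convergent_to g 0 F"
  shows "uo_convergent_to (\<lambda>i. f i + g i) 0 F"
  unfolding uo_convergent_to_def
proof (intro allI impI)
  fix y :: 'a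
  assume y: "0 \<le> y"
  show "order_convergent_to (\<lambda>i. inf \<bar>f i + g i - 0\<bar> y) 0 F"
  proof (rule order_convergent_to_0_sum_bound)
    show "order_convergent_to (\<lambda>i. inf \<bar>f i - 0\<bar> y) 0 F" "order_convergent_to (\<lambda>i. inf \<bar>g i - 0\<bar> y) 0 F"
      using assms y unfolding uo_convergent_to_def by blast+
    fix i
    have "inf \<bar>f i + g i\<bar> y \<le> inf (\<bar>f i\<bar> + \<bar>g i\<bar>) y"
      by (intro inf_mono abs_triangle_ineq order_refl)
    also have "\<dots> \<le> (inf \<bar>f i\<bar> y) + (inf \<bar>g i\<bar> y)"
      by (intro inf_add_le_add_inf abs_ge_zero y)
    \<comment> \<open>As \<open>y \<ge> 0\<close>, all three truncations are nonnegative and equal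
      their absolute values.\<close>
    finally show "\<bar>inf (\<bar>f i + g i - 0\<bar>) y\<bar> \<le> \<bar>inf (\<bar>f i - 0\<bar>) y\<bar> + \<bar>inf (\<bar>g i - 0\<bar>) y\<bar>"
      using y by simp
  qed
qed

lemma uo_convergent_to_0_minus:
  "uo_convergent_to f 0 F \<Longrightarrow> uo_convergent_to (\<lambda>i. - f i) 0 F"
  by (simp add: uo_convergent_to_def)

text \<open>A bounded functional composed with \<open>S\<close> is again a bounded functional, which
  can be tested on \<open>x\<close>.\<close>

lemma weakly_null_bounded_linear:
  assumes "bounded_linear S" "weakly_null x"
  shows "weakly_null (\<lambda>n. S (x n))"
  using assms bounded_linear_compose unfolding weakly_null_def by blast

lemma bounded_linear_funpow:
  fixes T :: "'a::real_normed_vector \<Rightarrow> 'a"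
  assumes "bounded_linear T"
  shows "bounded_linear (T ^^ n)"
  using assms
proof (induction n)
  case 0
  then show ?case by (simp add: id_def)
next
  case (Suc n)
  then show ?case
    using bounded_linear_compose[of T "T ^^ n"] by (simp add: comp_def)
qed

theorem proposition5p3:
  fixes T :: "'a::banach_lattice \<Rightarrow> 'a"
  assumes "bounded_linear T"
    and "sigma_weak_uo_continuous T"
    and "power_uo_demi_dunford_pettis T"
  shows "uo_demi_dunford_pettis T"
  unfolding uo_demi_dunford_pettis_def
proof (intro conjI allI impI)
  show "bounded_linear T" by fact
  fix x
  assume "weakly_null x \<and> uo_convergent_to (\<lambda>n. x n - T (x n)) 0 sequentially"
  then have x: "weakly_null x" and uo: "uo_convergent_to (\<lambda>n. x n - T (x n)) 0 sequentially"
    by auto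
  obtain m where "m \<ge> 1" and m: "uo_demi_dunford_pettis (T ^^ m)"
    using assms(3) unfolding power_uo_demi_dunford_pettis_def by blast
  \<comment> \<open>Since \<open>m \<ge> 1\<close>, the power \<open>T ^^ m\<close> has an outermost
    factor \<open>T\<close>. Continuity is applied to this factor, along the sequence
    \<open>(T ^^ k) (x n)\<close>.\<close>
  then obtain k where k: "m = Suc k"
    by (cases m) auto
  have T_uo: "uo_convergent_to (\<lambda>n. T (z n)) 0 sequentially" if "weakly_null z" for z
    using assms(2) that unfolding sigma_weak_uo_continuous_def by blast
  have "weakly_null (\<lambda>n. (T ^^ k) (x n))"
    by (rule weakly_null_bounded_linear[OF bounded_linear_funpow[OF assms(1)] x])
  then have "uo_convergent_to (\<lambda>n. - (T ^^ m) (x n)) 0 sequentially"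
    using uo_convergent_to_0_minus[OF T_uo] by (simp add: k)
  from uo_convergent_to_0_add[OF uo_convergent_to_0_add[OF uo T_uo[OF x]] this]
  have "uo_convergent_to (\<lambda>n. x n - (T ^^ m) (x n)) 0 sequentially"
    by simp
  then show "(\<lambda>n. norm (x n)) \<longlonglongrightarrow> 0"
    using m x unfolding uo_demi_dunford_pettis_def by blast
qed

end
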